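(* Let $n\geq 1$ be an integer and let $a,b,c,d$ be nonnegative integers with $0\leq b,d\leq n-1$. If $n$ is odd, then $$D_q(an+b,cn+d)\equiv D(a,c)\,D_q(b,d)\pmod{\Phi_n(q)},$$ and if $n$ is even, then $$D_q(an+b,cn+d)\equiv D_q(b,d)\pmod{\Phi_n(q)},$$ where the congruences are in the polynomial ring $\mathbb{Z}[q]$.
   Context: $\Phi_n(q)$ denotes the $n$-th cyclotomic polynomial. The $q$-integer is $[m]_q=(1-q^m)/(1-q)$ and the $q$-binomial coefficient is $\left[{h\atop k}\right]_q=\frac{[h]_q[h-1]_q\cdots[h-k+1]_q}{[k]_q[k-1]_q\cdots[1]_q}$, with $\left[{h\atop 0}\right]_q=1$ and $\left[{h\atop k}\right]_q=0$ for $k<0$. For nonnegative integers $h,k$ the $q$-Delannoy number is $D_q(h,k)=\sum_{j=0}^{h}q^{\binom{j+1}{2}}\left[{k\atop j}\right]_q\left[{h+k-j\atop k}\right]_q$. $D(a,c)$ is the classical Delannoy number, i.e. the number of lattice paths from $(0,0)$ to $(a,c)$ using only the steps $(1,0)$, $(0,1)$, $(1,1)$; equivalently $D(a,c)=\sum_{j\ge 0}2^j\binom{a}{j}\binom{c}{j}$. *)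

theory Defs
  imports Complex_Main "HOL-Computational_Algebra.Computational_Algebra"
begin

section \<open>Cyclotomic polynomials\<close>

definition primitive_roots :: "nat \<Rightarrow> complex set" where
  "primitive_roots n = {z. z ^ n = 1 \<and> (\<forall>m. 0 < m \<and> m < n \<longrightarrow> z ^ m \<noteq> 1)}"

text \<open>
  The polynomial with integer coefficients whose image over the complex numbers is the monic
  polynomial with simple roots at the primitive \<open>n\<close>-th roots of unity. Existence and uniqueness
  for \<open>n > 0\<close> is lemma \<open>cyclotomic_poly_spec\<close> below.
\<close>
definition cyclotomic_poly :: "nat \<Rightarrow> int poly" where
  "cyclotomic_poly n = (THE p. map_poly of_int p = (\<Prod>z\<in>primitive_roots n. [:- z, 1:]))"

lemma of_int_poly_mult:
  "map_poly (of_int :: int \<Rightarrow> complex) (p * q) = map_poly of_int p * map_poly of_int q"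
  by (rule poly_eqI) (simp add: coeff_map_poly coeff_mult)

lemma of_int_poly_add:
  "map_poly (of_int :: int \<Rightarrow> complex) (p + q) = map_poly of_int p + map_poly of_int q"
  by (rule poly_eqI) (simp add: coeff_map_poly)

lemma of_int_poly_diff:
  "map_poly (of_int :: int \<Rightarrow> complex) (p - q) = map_poly of_int p - map_poly of_int q"
  by (rule poly_eqI) (simp add: coeff_map_poly)

lemma of_int_poly_prod:
  "map_poly (of_int :: int \<Rightarrow> complex) (\<Prod>x\<in>A. f x) = (\<Prod>x\<in>A. map_poly of_int (f x))"
  by (induction A rule: infinite_finite_induct) (simp_all add: of_int_poly_mult)

lemma of_int_poly_inj:
  "map_poly (of_int :: int \<Rightarrow> complex) p = map_poly of_int q \<Longrightarrow> p = q"
  by (rule poly_eqI) (metis coeff_map_poly of_int_0 of_int_eq_iff)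

lemma of_int_poly_degree:
  "degree (map_poly (of_int :: int \<Rightarrow> complex) p) = degree p"
  by (rule degree_map_poly) simp

lemma lead_coeff_prod_linear:
  "lead_coeff (\<Prod>z\<in>A. [:- z, 1 :: complex:]) = 1"
  by (induction A rule: infinite_finite_induct) (simp_all add: lead_coeff_mult del: mult_pCons_left)

lemma degree_prod_linear:
  "finite A \<Longrightarrow> degree (\<Prod>z\<in>A. [:- z, 1 :: complex:]) = card A"
  by (subst degree_prod_eq_sum_degree) auto

lemma roots_unity_factorization:
  assumes "n > 0"
  shows "(\<Prod>z | z ^ n = 1. [:- z, 1 :: complex:]) = monom 1 n - 1" (is "?R = ?L")
proof (rule ccontr)
  let ?A = "{z :: complex. z ^ n = 1}"
  define p where "p = ?L - ?R"
  assume "?R \<noteq> ?L"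
  then have p0: "p \<noteq> 0" by (auto simp: p_def)
  have fin: "finite ?A" using assms by (intro finite_roots_unity) simp
  have crd: "card ?A = n" using assms by (rule card_roots_unity_eq)
  have dR: "degree ?R = n" using degree_prod_linear[OF fin] crd by simp
  have lR: "coeff ?R n = 1" using lead_coeff_prod_linear[of ?A] dR by simp
  have dL: "degree ?L \<le> n" by (rule degree_diff_le) (auto simp: degree_monom_le)
  have lL: "coeff ?L n = 1" using assms by simp
  have "degree p \<le> n" unfolding p_def by (rule degree_diff_le[OF dL]) (use dR in simp)
  moreover have "coeff p n = 0" unfolding p_def using lL lR by simp
  ultimately have "degree p < n"
    using p0 by (metis leading_coeff_0_iff le_neq_implies_less)
  moreover have "?A \<subseteq> {z. poly p z = 0}"
    using fin by (auto simp: p_def poly_monom poly_prod prod_zero_iff)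
  then have "n \<le> card {z. poly p z = 0}"
    using crd card_mono[OF poly_roots_finite[OF p0]] by metis
  moreover have "card {z. poly p z = 0} \<le> degree p" by (rule card_poly_roots_bound[OF p0])
  ultimately show False by simp
qed

lemma primitive_roots_disjoint:
  assumes "d > 0" "e > 0" "d \<noteq> e"
  shows "primitive_roots d \<inter> primitive_roots e = {}"
  using assms by (auto simp: primitive_roots_def) (metis linorder_neqE_nat)

lemma roots_unity_eq_Union_primitive_roots:
  assumes "n > 0"
  shows "{z :: complex. z ^ n = 1} = (\<Union>d\<in>{d. d dvd n}. primitive_roots d)"
proof (intro equalityI subsetI)
  fix z :: complex assume "z \<in> {z. z ^ n = 1}"
  then have z: "z ^ n = 1" by simp
  define d where "d = (LEAST m. 0 < m \<and> z ^ m = 1)"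
  have d: "0 < d \<and> z ^ d = 1" unfolding d_def by (rule LeastI[of _ n]) (use z assms in simp)
  have min: "z ^ m \<noteq> 1" if "0 < m" "m < d" for m
    using not_less_Least[of m "\<lambda>m. 0 < m \<and> z ^ m = 1"] that by (auto simp: d_def)
  have "z ^ n = (z ^ d) ^ (n div d) * z ^ (n mod d)"
    by (simp flip: power_mult power_add)
  then have "z ^ (n mod d) = 1" using z d by simp
  then have "n mod d = 0" using min[of "n mod d"] d by auto
  then have "d dvd n" by auto
  moreover have "z \<in> primitive_roots d" using d min by (auto simp: primitive_roots_def)
  ultimately show "z \<in> (\<Union>d\<in>{d. d dvd n}. primitive_roots d)" by auto
qed (auto simp: primitive_roots_def power_mult elim!: dvdE)

lemma finite_primitive_roots: "n > 0 \<Longrightarrow> finite (primitive_roots n)"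
  by (rule finite_subset[of _ "{z. z ^ n = 1}"])
     (auto simp: primitive_roots_def intro!: finite_roots_unity)

lemma prod_primitive_roots_dvd:
  assumes "n > 0"
  shows "(\<Prod>d | d dvd n. \<Prod>z\<in>primitive_roots d. [:- z, 1 :: complex:]) = monom 1 n - 1"
proof -
  have pos: "d > 0" if "d dvd n" for d using that assms by (auto intro: Nat.gr0I)
  have "(\<Prod>z\<in>(\<Union>d\<in>{d. d dvd n}. primitive_roots d). [:- z, 1 :: complex:])
      = (\<Prod>d | d dvd n. \<Prod>z\<in>primitive_roots d. [:- z, 1:])"
  proof (rule prod.UNION_disjoint)
    show "finite {d. d dvd n}" using assms by simp
    show "\<forall>d\<in>{d. d dvd n}. finite (primitive_roots d)"
      using pos finite_primitive_roots by blast
    show "\<forall>d\<in>{d. d dvd n}. \<forall>e\<in>{d. d dvd n}. d \<noteq> e \<longrightarrow> primitive_roots d \<inter> primitive_roots e = {}"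
      using pos primitive_roots_disjoint by blast
  qed
  then show ?thesis
    using roots_unity_factorization[OF assms] roots_unity_eq_Union_primitive_roots[OF assms] by simp
qed

lemma cyclotomic_poly_exists:
  "n > 0 \<Longrightarrow> \<exists>p :: int poly. map_poly of_int p = (\<Prod>z\<in>primitive_roots n. [:- z, 1:])"
proof (induction n rule: less_induct)
  case (less n)
  define C where "C d = (\<Prod>z\<in>primitive_roots d. [:- z, 1 :: complex:])" for d
  define D where "D = {d. d dvd n} - {n}"
  have finD: "finite {d. d dvd n}" using less.prems by simp
  have "\<exists>p. map_poly of_int p = C d" if "d \<in> D" for d
  proof -
    have "d > 0" "d < n"
      using that less.prems dvd_imp_le[of d n] by (auto simp: D_def intro: Nat.gr0I)
    then show ?thesis using less.IH unfolding C_def by blast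
  qed
  then obtain P where P: "\<And>d. d \<in> D \<Longrightarrow> map_poly of_int (P d) = C d" by metis
  define Q where "Q = (\<Prod>d\<in>D. P d)"
  have Q: "map_poly of_int Q = (\<Prod>d\<in>D. C d)" by (simp add: Q_def of_int_poly_prod P)
  have "lead_coeff (\<Prod>d\<in>D. C d) = 1"
    by (simp add: lead_coeff_prod C_def lead_coeff_prod_linear)
  then have "of_int (lead_coeff Q) = (1 :: complex)"
    by (simp flip: Q add: of_int_poly_degree coeff_map_poly)
  then have lc: "lead_coeff Q = 1" by simp
  then have Q0: "Q \<noteq> 0" by auto
  obtain S R where SR: "pseudo_divmod (monom 1 n - 1) Q = (S, R)" by fastforce
  have eq: "monom 1 n - 1 = Q * S + R" and dR: "R = 0 \<or> degree R < degree Q"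
    using pseudo_divmod[OF Q0 SR] lc by auto
  have "map_poly of_int (monom 1 n - 1 :: int poly) = (monom 1 n - 1 :: complex poly)"
    by (simp add: of_int_poly_diff map_poly_monom)
  also have "\<dots> = (\<Prod>d | d dvd n. C d)"
    using prod_primitive_roots_dvd[OF less.prems] by (simp add: C_def)
  also have "\<dots> = C n * map_poly of_int Q"
    unfolding Q D_def by (rule prod.remove[OF finD]) simp
  finally have "map_poly of_int Q * map_poly of_int S + map_poly of_int R = C n * map_poly of_int Q"
    by (simp add: eq of_int_poly_add of_int_poly_mult)
  then have R: "map_poly of_int R = map_poly of_int Q * (C n - map_poly of_int S)"
    by (simp add: algebra_simps)
  have "C n - map_poly of_int S = 0"
  proof (rule ccontr)
    assume nz: "C n - map_poly of_int S \<noteq> 0"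
    have Q0': "map_poly (of_int :: int \<Rightarrow> complex) Q \<noteq> 0"
      using Q0 of_int_poly_inj[of Q 0] by auto
    have "degree R = degree Q + degree (C n - map_poly of_int S)"
      using arg_cong[OF R, of degree] degree_mult_eq[OF Q0' nz] by (simp add: of_int_poly_degree)
    moreover have "R \<noteq> 0" using R nz Q0' by auto
    ultimately show False using dR by simp
  qed
  then show ?case by (auto simp: C_def)
qed

lemma cyclotomic_poly_spec:
  assumes "n > 0"
  shows "map_poly of_int (cyclotomic_poly n) = (\<Prod>z\<in>primitive_roots n. [:- z, 1:])"
  unfolding cyclotomic_poly_def
  by (rule theI') (use cyclotomic_poly_exists[OF assms] of_int_poly_inj in metis)


section \<open>\<open>q\<close>-integers, \<open>q\<close>-binomial coefficients and \<open>q\<close>-Delannoy numbers\<close>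

text \<open>
  Everything is a polynomial in the indeterminate \<open>q\<close> over the integers. Both divisions below are
  exact (lemmas \<open>q_int_mult\<close> and \<open>q_binom_mult\<close>). The natural subtraction in \<open>q_binom\<close> truncates
  only for \<open>k > h\<close>, when the numerator already has the factor \<open>[0] = 0\<close>.
\<close>

definition qX :: "int poly" where "qX = [:0, 1:]"

definition q_int :: "nat \<Rightarrow> int poly" where
  "q_int m = (1 - qX ^ m) div (1 - qX)"

definition q_binom :: "nat \<Rightarrow> nat \<Rightarrow> int poly" where
  "q_binom h k = (\<Prod>i<k. q_int (h - i)) div (\<Prod>i=1..k. q_int i)"

definition q_delannoy :: "nat \<Rightarrow> nat \<Rightarrow> int poly" where
  "q_delannoy h k = (\<Sum>j=0..h. qX ^ (Suc j choose 2) * q_binom k j * q_binom (h + k - j) k)"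

lemma one_minus_qX_nonzero: "1 - qX \<noteq> 0"
  by (simp add: qX_def one_pCons)

lemma q_int_eq_sum: "q_int m = (\<Sum>i<m. qX ^ i)"
  unfolding q_int_def one_diff_power_eq using one_minus_qX_nonzero by simp

lemma q_int_mult: "(1 - qX) * q_int m = 1 - qX ^ m"
  by (simp add: q_int_eq_sum one_diff_power_eq)

lemma q_int_nonzero:
  assumes "m > 0" shows "q_int m \<noteq> 0"
proof
  assume "q_int m = 0"
  then have "poly (1 - qX ^ m) 0 = 0" using q_int_mult[of m] by (metis mult_zero_right poly_0)
  then show False using assms by (simp add: qX_def power_0_left)
qed

lemma q_int_add: "q_int (m + n) = q_int m + qX ^ m * q_int n"
proof -
  have "(1 - qX) * q_int (m + n) = (1 - qX) * (q_int m + qX ^ m * q_int n)"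
    unfolding distrib_left mult.left_commute[of "1 - qX"] q_int_mult
    by (simp add: algebra_simps power_add)
  then show ?thesis using one_minus_qX_nonzero by simp
qed

lemma q_binom_dvd: "(\<Prod>i=1..k. q_int i) dvd (\<Prod>i<k. q_int (h - i))"
proof (induction h arbitrary: k)
  case 0
  show ?case by (cases k) (auto simp: q_int_eq_sum prod.lessThan_Suc_shift)
next
  case (Suc h)
  show ?case
  proof (cases k)
    case (Suc l)
    have sh: "(\<Prod>i<k. q_int (Suc h - i)) = q_int (Suc h) * (\<Prod>i<l. q_int (h - i))"
      unfolding Suc by (simp add: prod.lessThan_Suc_shift del: prod.lessThan_Suc)
    show ?thesis
    proof (cases "l \<le> h")
      case True
      have "q_int (Suc h) = q_int (Suc l) + qX ^ Suc l * q_int (h - l)"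
        using q_int_add[of "Suc l" "h - l"] True by simp
      then have "(\<Prod>i<k. q_int (Suc h - i)) =
          q_int (Suc l) * (\<Prod>i<l. q_int (h - i)) + qX ^ Suc l * (\<Prod>i<k. q_int (h - i))"
        unfolding sh unfolding Suc by (simp add: algebra_simps)
      moreover have "(\<Prod>i=1..k. q_int i) dvd q_int (Suc l) * (\<Prod>i<l. q_int (h - i))"
        unfolding Suc using mult_dvd_mono[OF dvd_refl Suc.IH[of l], of "q_int (Suc l)"]
        by (simp add: mult.commute)
      moreover have "(\<Prod>i=1..k. q_int i) dvd qX ^ Suc l * (\<Prod>i<k. q_int (h - i))"
        by (rule dvd_mult[OF Suc.IH])
      ultimately show ?thesis by simp
    next
      case False
      then have z: "(\<Prod>i<l. q_int (h - i)) = 0"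
        by (intro prod_zero) (auto simp: q_int_eq_sum intro!: bexI[of _ h])
      show ?thesis unfolding sh z by simp
    qed
  qed simp
qed

lemma q_binom_mult: "(\<Prod>i=1..k. q_int i) * q_binom h k = (\<Prod>i<k. q_int (h - i))"
  unfolding q_binom_def using q_binom_dvd by (rule dvd_mult_div_cancel)


section \<open>Delannoy numbers\<close>

text \<open>A lattice path starting at the origin is given by its list of steps.\<close>

definition delannoy_paths :: "nat \<Rightarrow> nat \<Rightarrow> (nat \<times> nat) list set" where
  "delannoy_paths a c =
     {ss. set ss \<subseteq> {(1, 0), (0, 1), (1, 1)} \<and> sum_list (map fst ss) = a \<and> sum_list (map snd ss) = c}"

definition delannoy :: "nat \<Rightarrow> nat \<Rightarrow> nat" where
  "delannoy a c = card (delannoy_paths a c)"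

lemma finite_delannoy_paths: "finite (delannoy_paths a c)"
proof -
  have len: "length ss \<le> sum_list (map fst ss) + sum_list (map snd ss)"
    if "set ss \<subseteq> {(1, 0), (0, 1), (1, 1)}" for ss :: "(nat \<times> nat) list"
    using that by (induction ss) auto
  have "delannoy_paths a c \<subseteq> {ss. set ss \<subseteq> {(1, 0), (0, 1), (1, 1)} \<and> length ss \<le> a + c}"
    using len by (auto simp: delannoy_paths_def)
  then show ?thesis
    by (rule finite_subset) (rule finite_lists_length_le, simp)
qed

end

theory Submission
  imports Defs
begin

text \<open>
  Let \<open>z\<close> be a primitive \<open>n\<close>-th root of unity. At \<open>q = z\<close> the \<open>q\<close>-binomial theorems give
  \<open>\<Sum>h. D(h, k) x^h = (\<Prod>i=1..k. 1 + z^i x) / (\<Prod>i=0..k. 1 - z^i x)\<close>. For \<open>k = c n + d\<close> complete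
  blocks of \<open>n\<close> factors collapse to \<open>1 \<plusminus> x^n\<close>, so the series is \<open>P(x) G(x^n)\<close> with a polynomial
  \<open>P\<close> of degree less than \<open>n\<close> that depends only on \<open>d\<close>, where \<open>G(y) = (1 + y)^c / (1 - y)^(c + 1)\<close>
  is the generating function of the Delannoy numbers \<open>D(a, c)\<close> if \<open>n\<close> is odd, and
  \<open>G(y) = 1 / (1 - y)\<close> if \<open>n\<close> is even. The theorem is read off from the coefficient of
  \<open>x^(a n + b)\<close>.
\<close>

section \<open>The two q-Pascal rules\<close>

lemma q_binom_0_right: "q_binom h 0 = 1"
  by (simp add: q_binom_def)

lemma q_binom_eq_0:
  assumes "h < k"
  shows "q_binom h k = 0"
proof -
  have "(\<Prod>i<k. q_int (h - i)) = 0"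
    using assms by (intro prod_zero) (auto simp: q_int_eq_sum intro!: bexI[of _ h])
  then show ?thesis by (simp only: q_binom_def div_0)
qed

lemma prod_q_int_nonzero: "(\<Prod>i=1..k. q_int i) \<noteq> 0"
  by (simp add: q_int_nonzero)

lemma prod_q_int_Suc:
  "(\<Prod>i<Suc k. q_int (Suc h - i)) = q_int (Suc h) * (\<Prod>i<k. q_int (h - i))"
  by (simp add: prod.lessThan_Suc_shift del: prod.lessThan_Suc)

text \<open>Brings \<open>q_binom h k\<close> to the denominator of
  \<open>q_binom h (Suc k)\<close>, so that both Pascal rules can be checked between numerators over
  one common denominator.\<close>

lemma q_binom_Suc_mult:
  "(\<Prod>i=1..Suc k. q_int i) * q_binom h k = q_int (Suc k) * (\<Prod>i<k. q_int (h - i))"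
proof -
  have "(\<Prod>i=1..Suc k. q_int i) * q_binom h k = q_int (Suc k) * ((\<Prod>i=1..k. q_int i) * q_binom h k)"
    by (simp add: mult_ac)
  then show ?thesis by (simp only: q_binom_mult)
qed

text \<open>Comes from splitting [h+1] = [k+1] + q^(k+1) [h-k]. It drives the recurrence of the
  column series in \<open>q_binom_column_fps_mult\<close>.\<close>

lemma q_binom_Suc_Suc:
  "q_binom (Suc h) (Suc k) = q_binom h k + qX ^ Suc k * q_binom h (Suc k)"
proof (cases "k \<le> h")
  case True
  let ?M = "\<Prod>i=1..Suc k. q_int i"
  have split: "q_int (Suc h) = q_int (Suc k) + qX ^ Suc k * q_int (h - k)"
    using q_int_add[of "Suc k" "h - k"] True by simp
  have "?M * (q_binom h k + qX ^ Suc k * q_binom h (Suc k)) =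
      ?M * q_binom h k + qX ^ Suc k * (?M * q_binom h (Suc k))"
    by (simp only: distrib_left mult.left_commute)
  also have "\<dots> = q_int (Suc k) * (\<Prod>i<k. q_int (h - i)) + qX ^ Suc k * (\<Prod>i<Suc k. q_int (h - i))"
    by (simp only: q_binom_Suc_mult q_binom_mult)
  also have "\<dots> = (\<Prod>i<Suc k. q_int (Suc h - i))"
    by (simp only: prod_q_int_Suc split prod.lessThan_Suc) (simp add: algebra_simps)
  also have "\<dots> = ?M * q_binom (Suc h) (Suc k)"
    by (simp only: q_binom_mult)
  finally show ?thesis
    using prod_q_int_nonzero[of "Suc k"] by (metis mult_left_cancel)
qed (simp add: q_binom_eq_0)

text \<open>Comes from the opposite splitting [h+1] = [h-k] + q^(h-k) [k+1]. Its weight q^(h-k) is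
  the one that fits the triangular exponents of the row series.\<close>

lemma q_binom_Suc_Suc':
  assumes "k \<le> h"
  shows "q_binom (Suc h) (Suc k) = qX ^ (h - k) * q_binom h k + q_binom h (Suc k)"
proof -
  let ?M = "\<Prod>i=1..Suc k. q_int i"
  have split: "q_int (Suc h) = q_int (h - k) + qX ^ (h - k) * q_int (Suc k)"
    using q_int_add[of "h - k" "Suc k"] assms by simp
  have "?M * (qX ^ (h - k) * q_binom h k + q_binom h (Suc k)) =
      qX ^ (h - k) * (?M * q_binom h k) + ?M * q_binom h (Suc k)"
    by (simp only: distrib_left mult.left_commute)
  also have "\<dots> = qX ^ (h - k) * (q_int (Suc k) * (\<Prod>i<k. q_int (h - i))) + (\<Prod>i<Suc k. q_int (h - i))"
    by (simp only: q_binom_Suc_mult q_binom_mult)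
  also have "\<dots> = (\<Prod>i<Suc k. q_int (Suc h - i))"
    by (simp only: prod_q_int_Suc split prod.lessThan_Suc) (simp add: algebra_simps)
  also have "\<dots> = ?M * q_binom (Suc h) (Suc k)"
    by (simp only: q_binom_mult)
  finally show ?thesis
    using prod_q_int_nonzero[of "Suc k"] by (metis mult_left_cancel)
qed

section \<open>Evaluation at complex points and divisibility by cyclotomic polynomials\<close>

definition int_poly_eval :: "complex \<Rightarrow> int poly \<Rightarrow> complex" where
  "int_poly_eval z p = poly (map_poly of_int p) z"

lemma int_poly_eval_simps [simp]:
  "int_poly_eval z 0 = 0"
  "int_poly_eval z 1 = 1"
  "int_poly_eval z qX = z"
  "int_poly_eval z (p + q) = int_poly_eval z p + int_poly_eval z q"
  "int_poly_eval z (p - q) = int_poly_eval z p - int_poly_eval z q"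
  "int_poly_eval z (p * q) = int_poly_eval z p * int_poly_eval z q"
  by (simp_all add: int_poly_eval_def of_int_poly_add of_int_poly_diff of_int_poly_mult qX_def
      map_poly_pCons)

lemma int_poly_eval_power [simp]: "int_poly_eval z (p ^ m) = int_poly_eval z p ^ m"
  by (induction m) simp_all

lemma int_poly_eval_of_nat [simp]: "int_poly_eval z (of_nat m) = of_nat m"
  by (induction m) simp_all

lemma int_poly_eval_sum [simp]: "int_poly_eval z (sum f A) = (\<Sum>x\<in>A. int_poly_eval z (f x))"
  by (induction A rule: infinite_finite_induct) simp_all

text \<open>Reduces a congruence over the integers to values at roots of unity: the remainder on
  division has smaller degree than the number of primitive roots, yet vanishes at all of
  them.\<close>

lemma cyclotomic_poly_dvdI:
  assumes "n > 0" and root: "\<And>z. z \<in> primitive_roots n \<Longrightarrow> int_poly_eval z p = 0"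
  shows "cyclotomic_poly n dvd p"
proof -
  let ?C = "cyclotomic_poly n"
  note spec = cyclotomic_poly_spec[OF assms(1)]
  note fin = finite_primitive_roots[OF assms(1)]
  have deg: "degree ?C = card (primitive_roots n)"
    using degree_prod_linear[OF fin] spec of_int_poly_degree[of ?C] by simp
  have "of_int (lead_coeff ?C) = (1 :: complex)"
    using lead_coeff_prod_linear[of "primitive_roots n"]
    by (simp flip: spec add: of_int_poly_degree coeff_map_poly)
  then have lc: "lead_coeff ?C = 1" by simp
  then have C0: "?C \<noteq> 0" by auto
  obtain S R where SR: "pseudo_divmod p ?C = (S, R)" by fastforce
  \<comment> \<open>The divisor is monic, so pseudo-division is division with remainder over the
    integers.\<close>
  have eq: "p = ?C * S + R" and dR: "R = 0 \<or> degree R < degree ?C"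
    using pseudo_divmod[OF C0 SR] lc by auto
  have "R = 0"
  proof (rule ccontr)
    assume "R \<noteq> 0"
    let ?R = "map_poly (of_int :: int \<Rightarrow> complex) R"
    have R0: "?R \<noteq> 0" using \<open>R \<noteq> 0\<close> of_int_poly_inj[of R 0] by auto
    have "poly ?R z = 0" if "z \<in> primitive_roots n" for z
    proof -
      have "int_poly_eval z ?C = 0"
        using that fin by (auto simp: int_poly_eval_def spec poly_prod prod_zero_iff)
      then show ?thesis
        using root[OF that] by (simp add: eq) (simp add: int_poly_eval_def)
    qed
    then have "card (primitive_roots n) \<le> card {z. poly ?R z = 0}"
      by (intro card_mono poly_roots_finite[OF R0]) auto
    also have "\<dots> \<le> degree R"
      using card_poly_roots_bound[OF R0] by (simp add: of_int_poly_degree)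
    finally show False using dR \<open>R \<noteq> 0\<close> deg by simp
  qed
  then show ?thesis using eq by simp
qed

section \<open>q-Pochhammer symbols (s x; z)_m as polynomials in x, and their collapse at roots of
  unity\<close>

definition q_pochhammer_poly :: "complex \<Rightarrow> complex \<Rightarrow> nat \<Rightarrow> complex poly" where
  "q_pochhammer_poly s z m = (\<Prod>i<m. [:1, - (s * z ^ i):])"

lemma q_pochhammer_poly_0 [simp]: "q_pochhammer_poly s z 0 = 1"
  by (simp add: q_pochhammer_poly_def)

lemma q_pochhammer_poly_Suc:
  "q_pochhammer_poly s z (Suc m) = q_pochhammer_poly s z m * [:1, - (s * z ^ m):]"
  unfolding q_pochhammer_poly_def by (rule prod.lessThan_Suc)

lemma q_pochhammer_poly_add:
  "q_pochhammer_poly s z (m + k) = q_pochhammer_poly s z m * q_pochhammer_poly (s * z ^ m) z k"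
proof (induction k)
  case (Suc k)
  show ?case
    unfolding add_Suc_right q_pochhammer_poly_Suc Suc
    by (simp add: power_add mult_ac del: mult_pCons_right)
qed simp

lemma degree_q_pochhammer_poly_le: "degree (q_pochhammer_poly s z m) \<le> m"
proof (induction m)
  case (Suc m)
  have "degree (q_pochhammer_poly s z (Suc m)) \<le>
      degree (q_pochhammer_poly s z m) + degree [:1, - (s * z ^ m):]"
    unfolding q_pochhammer_poly_Suc by (rule degree_mult_le)
  also have "\<dots> \<le> m + 1" by (intro add_mono Suc) simp
  finally show ?case by simp
qed simp

lemma inj_on_power_primitive_root:
  assumes "z \<in> primitive_roots n"
  shows "inj_on (\<lambda>i. z ^ i) {..<n}"
proof (rule linorder_inj_onI')
  fix i j assume ij: "i \<in> {..<n}" "j \<in> {..<n}" "i < j"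
  have "z \<noteq> 0" using assms ij by (auto simp: primitive_roots_def power_0_left split: if_splits)
  then have "z ^ (j - i) = 1" if "z ^ i = z ^ j"
    using that ij by (simp add: power_diff)
  then show "z ^ i \<noteq> z ^ j"
    using assms ij by (auto simp: primitive_roots_def)
qed

text \<open>Both sides have degree at most n, so agreement at n + 1 points suffices: the n distinct
  common roots 1/(s z^i), and 0, where both sides equal 1.\<close>

lemma q_pochhammer_poly_primitive_root:
  assumes "n > 0" and z: "z \<in> primitive_roots n" and "s \<noteq> 0"
  shows "q_pochhammer_poly s z n = 1 - monom (s ^ n) n"
proof -
  have zn: "z ^ n = 1" using z by (simp add: primitive_roots_def)
  then have z0: "z \<noteq> 0" using assms(1) by (auto simp: power_0_left)
  define A where "A = (\<lambda>i. inverse (s * z ^ i)) ` {..<n}"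
  have "inj_on (\<lambda>i. inverse (s * z ^ i)) {..<n}"
    using inj_on_power_primitive_root[OF z] \<open>s \<noteq> 0\<close> by (auto simp: inj_on_def)
  then have card: "card A = n" by (simp add: A_def card_image)
  have "0 \<notin> A" using z0 \<open>s \<noteq> 0\<close> by (auto simp: A_def)
  then have card': "card (insert 0 A) = Suc n"
    using card by (simp add: A_def)
  show ?thesis
  proof (rule poly_eqI_degree[of "insert 0 A"])
    fix x assume "x \<in> insert 0 A"
    then show "poly (q_pochhammer_poly s z n) x = poly (1 - monom (s ^ n) n) x"
    proof
      assume "x = 0"
      then show ?thesis
        using assms(1) by (simp add: q_pochhammer_poly_def poly_prod poly_monom)
    next
      assume "x \<in> A"
      then obtain i where i: "i < n" and x: "x = inverse (s * z ^ i)"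
        by (auto simp: A_def)
      have "poly (q_pochhammer_poly s z n) x = 0"
        unfolding q_pochhammer_poly_def poly_prod
        using i z0 \<open>s \<noteq> 0\<close> by (intro prod_zero bexI[of _ i]) (auto simp: x field_simps)
      moreover have "(z ^ i) ^ n = 1"
        by (metis zn mult.commute power_mult power_one)
      then have "s ^ n * x ^ n = 1"
        using \<open>s \<noteq> 0\<close> by (simp add: x power_inverse power_mult_distrib)
      ultimately show ?thesis by (simp add: poly_monom)
    qed
  next
    show "degree (q_pochhammer_poly s z n) < card (insert 0 A)"
      using degree_q_pochhammer_poly_le[of s z n] card' by simp
    have "degree (1 - monom (s ^ n) n) \<le> n"
      by (rule degree_diff_le) (auto simp: degree_monom_le)
    then show "degree (1 - monom (s ^ n) n) < card (insert 0 A)"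
      using card' by simp
  qed
qed

text \<open>Passing a block of n factors replaces s by s z^n = s, so every complete block
  contributes the same polynomial.\<close>

lemma q_pochhammer_poly_mult_add:
  assumes "n > 0" and z: "z \<in> primitive_roots n" and "s \<noteq> 0"
  shows "q_pochhammer_poly s z (c * n + k) = (1 - monom (s ^ n) n) ^ c * q_pochhammer_poly s z k"
proof (induction c)
  case (Suc c)
  have "z ^ n = 1" using z by (simp add: primitive_roots_def)
  then have "q_pochhammer_poly s z (Suc c * n + k) =
      q_pochhammer_poly s z n * q_pochhammer_poly s z (c * n + k)"
    using q_pochhammer_poly_add[of s z n "c * n + k"] by (simp add: add_ac)
  then show ?case by (simp add: Suc q_pochhammer_poly_primitive_root[OF assms])
qed simp

section \<open>Generating functions of q-binomial coefficients and q-Delannoy numbers\<close>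

definition q_binom_row_fps :: "complex \<Rightarrow> nat \<Rightarrow> complex fps" where
  "q_binom_row_fps z k = Abs_fps (\<lambda>j. z ^ (Suc j choose 2) * int_poly_eval z (q_binom k j))"

definition q_binom_column_fps :: "complex \<Rightarrow> nat \<Rightarrow> complex fps" where
  "q_binom_column_fps z k = Abs_fps (\<lambda>m. int_poly_eval z (q_binom (m + k) k))"

definition q_delannoy_fps :: "complex \<Rightarrow> nat \<Rightarrow> complex fps" where
  "q_delannoy_fps z k = Abs_fps (\<lambda>h. int_poly_eval z (q_delannoy h k))"

text \<open>Turns multiplication by one linear factor into a two-term recurrence for coefficients,
  the form in which the Pascal rules apply.\<close>

lemma fps_nth_mult_linear:
  "(f * fps_of_poly [:1, a:]) $ m = f $ m + (if m = 0 then 0 else a * f $ (m - 1))"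
  for f :: "complex fps"
proof -
  have "f * fps_of_poly [:1, a:] = f + fps_const a * (f * fps_X)"
    by (simp add: fps_of_poly_linear' algebra_simps)
  then show ?thesis by simp
qed

text \<open>The finite q-binomial theorem. The choice s = -z makes the factors 1 + z^i x for i = 1,
  ..., k.\<close>

lemma q_binom_row_fps_eq:
  "q_binom_row_fps z k = fps_of_poly (q_pochhammer_poly (- z) z k)"
proof (induction k)
  case 0
  show ?case
  proof (rule fps_ext)
    fix j show "q_binom_row_fps z 0 $ j = fps_of_poly (q_pochhammer_poly (- z) z 0) $ j"
      by (cases j) (simp_all add: q_binom_row_fps_def q_binom_0_right q_binom_eq_0 binomial_eq_0)
  qed
next
  case (Suc k)
  have "q_binom_row_fps z (Suc k) = q_binom_row_fps z k * fps_of_poly [:1, z ^ Suc k:]"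
  proof (rule fps_ext)
    fix j
    show "q_binom_row_fps z (Suc k) $ j = (q_binom_row_fps z k * fps_of_poly [:1, z ^ Suc k:]) $ j"
    proof (cases j)
      case 0
      then show ?thesis by (simp add: q_binom_row_fps_def q_binom_0_right fps_nth_mult_linear)
    next
      case (Suc i)
      have tri: "Suc (Suc i) choose 2 = (Suc i choose 2) + Suc i"
        by (simp add: numeral_2_eq_2)
      have "z ^ (Suc (Suc i) choose 2) * int_poly_eval z (q_binom (Suc k) (Suc i)) =
          z ^ (Suc (Suc i) choose 2) * int_poly_eval z (q_binom k (Suc i)) +
          z ^ Suc k * (z ^ (Suc i choose 2) * int_poly_eval z (q_binom k i))"
      proof (cases "i \<le> k")
        case True
        \<comment> \<open>The factor z^(i+1) raises the triangular exponent to that of the next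
          index, and z^(k-i) is the weight in the Pascal rule.\<close>
        have pow: "z ^ Suc k = z ^ Suc i * z ^ (k - i)"
          using True by (simp flip: power_add)
        show ?thesis
          unfolding q_binom_Suc_Suc'[OF True] tri pow by (simp add: power_add algebra_simps)
      qed (simp add: q_binom_eq_0)
      then show ?thesis
        by (simp add: Suc q_binom_row_fps_def fps_nth_mult_linear)
    qed
  qed
  then show ?case
    by (simp add: Suc q_pochhammer_poly_Suc fps_of_poly_mult del: mult_pCons_right)
qed

text \<open>The q-binomial theorem for negative exponents, with the denominator multiplied out. By
  the first Pascal rule, multiplying by the last factor lowers k by one.\<close>

lemma q_binom_column_fps_mult:
  "q_binom_column_fps z k * fps_of_poly (q_pochhammer_poly 1 z (Suc k)) = 1"
proof (induction k)
  case 0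
  have "q_binom_column_fps z 0 * fps_of_poly [:1, - 1:] = 1"
    by (rule fps_ext) (simp add: fps_nth_mult_linear q_binom_column_fps_def q_binom_0_right)
  then show ?case by (simp add: q_pochhammer_poly_def)
next
  case (Suc k)
  have "q_binom_column_fps z (Suc k) * fps_of_poly [:1, - (z ^ Suc k):] = q_binom_column_fps z k"
  proof (rule fps_ext)
    fix m
    show "(q_binom_column_fps z (Suc k) * fps_of_poly [:1, - (z ^ Suc k):]) $ m =
        q_binom_column_fps z k $ m"
    proof (cases m)
      case 0
      then show ?thesis
        by (simp add: q_binom_column_fps_def q_binom_Suc_Suc[of k k] q_binom_eq_0
            fps_nth_mult_linear)
    next
      case (Suc l)
      then show ?thesis
        by (simp add: q_binom_column_fps_def q_binom_Suc_Suc[of "Suc (l + k)" k]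
            fps_nth_mult_linear)
    qed
  qed
  then have "q_binom_column_fps z (Suc k) * fps_of_poly (q_pochhammer_poly 1 z (Suc (Suc k))) =
      q_binom_column_fps z k * fps_of_poly (q_pochhammer_poly 1 z (Suc k))"
    unfolding q_pochhammer_poly_Suc[of _ _ "Suc k"] fps_of_poly_mult by (simp add: mult_ac)
  then show ?case by (simp only: Suc)
qed

text \<open>The defining sum is a Cauchy product, because h + k - j = (h - j) + k for j at most
  h.\<close>

lemma q_delannoy_fps_eq_mult: "q_delannoy_fps z k = q_binom_row_fps z k * q_binom_column_fps z k"
proof (rule fps_ext)
  fix h
  have "h + k - j = h - j + k" if "j \<le> h" for j using that by simp
  then show "q_delannoy_fps z k $ h = (q_binom_row_fps z k * q_binom_column_fps z k) $ h"
    by (auto simp: q_delannoy_fps_def q_binom_row_fps_def q_binom_column_fps_def fps_mult_nth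
        q_delannoy_def intro!: sum.cong)
qed

lemma q_delannoy_fps_mult:
  "q_delannoy_fps z k * fps_of_poly (q_pochhammer_poly 1 z (Suc k)) =
     fps_of_poly (q_pochhammer_poly (- z) z k)"
  by (simp add: q_delannoy_fps_eq_mult mult.assoc q_binom_column_fps_mult q_binom_row_fps_eq)

section \<open>Classical Delannoy numbers and their generating function\<close>

definition delannoy_fps :: "nat \<Rightarrow> complex fps" where
  "delannoy_fps c = Abs_fps (\<lambda>a. of_nat (delannoy a c))"

lemma delannoy_paths_0_0: "delannoy_paths 0 0 = {[]}"
proof -
  have "ss = []" if "ss \<in> delannoy_paths 0 0" for ss
    using that by (cases ss) (auto simp: delannoy_paths_def)
  then show ?thesis by (auto simp: delannoy_paths_def)
qed

text \<open>A nonempty path is classified by its first step.\<close>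

lemma delannoy_paths_rec:
  assumes "a + c > 0"
  shows "delannoy_paths a c =
    (if a > 0 then (#) (1, 0) ` delannoy_paths (a - 1) c else {}) \<union>
    (if c > 0 then (#) (0, 1) ` delannoy_paths a (c - 1) else {}) \<union>
    (if a > 0 \<and> c > 0 then (#) (1, 1) ` delannoy_paths (a - 1) (c - 1) else {})" (is "_ = ?R")
proof (intro equalityI subsetI)
  fix ss assume ss: "ss \<in> delannoy_paths a c"
  then obtain s t where "ss = s # t"
    using assms by (cases ss) (auto simp: delannoy_paths_def)
  then show "ss \<in> ?R"
    using ss by (auto simp: delannoy_paths_def image_iff simp del: sum_list_eq_0_iff)
qed (auto simp: delannoy_paths_def split: if_splits)

lemma delannoy_0_left: "delannoy 0 c = 1"
proof (induction c)
  case (Suc c)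
  then show ?case by (simp add: delannoy_def delannoy_paths_rec[of 0 "Suc c"] card_image)
qed (simp add: delannoy_def delannoy_paths_0_0)

lemma delannoy_0_right: "delannoy a 0 = 1"
proof (induction a)
  case (Suc a)
  then show ?case by (simp add: delannoy_def delannoy_paths_rec[of "Suc a" 0] card_image)
qed (simp add: delannoy_0_left)

lemma delannoy_Suc_Suc:
  "delannoy (Suc a) (Suc c) = delannoy a (Suc c) + delannoy (Suc a) c + delannoy a c"
proof -
  have "delannoy_paths (Suc a) (Suc c) =
    ((#) (1, 0) ` delannoy_paths a (Suc c) \<union> (#) (0, 1) ` delannoy_paths (Suc a) c) \<union>
    (#) (1, 1) ` delannoy_paths a c"
    by (subst delannoy_paths_rec) auto
  then show ?thesis
    unfolding delannoy_def
    by (simp only:) (subst card_Un_disjoint; auto simp: finite_delannoy_paths card_image card_Un_disjoint)+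
qed

text \<open>The three-term recurrence says that raising c by one multiplies the series by (1 + x)/(1
  - x).\<close>

lemma delannoy_fps_mult: "delannoy_fps c * (1 - fps_X) ^ Suc c = (1 + fps_X) ^ c"
proof (induction c)
  case 0
  show ?case by (rule fps_ext) (simp add: delannoy_fps_def delannoy_0_right algebra_simps)
next
  case (Suc c)
  have "delannoy_fps (Suc c) * (1 - fps_X) = delannoy_fps c * (1 + fps_X)"
  proof (rule fps_ext)
    fix a show "(delannoy_fps (Suc c) * (1 - fps_X)) $ a = (delannoy_fps c * (1 + fps_X)) $ a"
      by (cases a) (simp_all add: delannoy_fps_def delannoy_0_left delannoy_Suc_Suc algebra_simps)
  qed
  then have "delannoy_fps (Suc c) * (1 - fps_X) ^ Suc (Suc c) =
      delannoy_fps c * (1 - fps_X) ^ Suc c * (1 + fps_X)"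
    by (simp add: mult_ac)
  then show ?case by (simp only: Suc power_Suc2[of "1 + fps_X"])
qed

section \<open>Substitution of x^n and evaluation at a primitive root of unity\<close>

lemma delannoy_fps_compose_mult:
  assumes "n > 0"
  shows "(delannoy_fps c oo fps_X ^ n) * (1 - fps_X ^ n) ^ Suc c = (1 + fps_X ^ n) ^ c"
proof -
  have X0: "(fps_X ^ n :: complex fps) $ 0 = 0" using assms by simp
  show ?thesis
    using arg_cong[OF delannoy_fps_mult[of c], of "\<lambda>f. f oo fps_X ^ n"]
    by (simp add: fps_compose_mult_distrib[OF X0] fps_compose_power[OF X0, symmetric] fps_compose_add_distrib
        fps_compose_sub_distrib fps_X_fps_compose_startby0[OF X0] del: power_Suc)
qed

text \<open>The second factor has only exponents divisible by n, so a term x^i of P contributes only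
  if i and b agree modulo n. Both are below n, which leaves i = b.\<close>

lemma fps_nth_poly_mult_compose_X_power:
  fixes G :: "'a :: idom fps"
  assumes "degree P < n" "b < n"
  shows "(fps_of_poly P * (G oo fps_X ^ n)) $ (a * n + b) = coeff P b * G $ a"
proof -
  have n: "n > 0" using assms by simp
  have "coeff P i * (G oo fps_X ^ n) $ (a * n + b - i) = 0"
    if i: "i \<in> {0..a * n + b} - {b}" for i
  proof (cases "i < n")
    case True
    have "\<not> n dvd a * n + b - i"
    proof
      assume "n dvd a * n + b - i"
      then obtain k where "a * n + b - i = n * k" ..
      then have "a * n + b = k * n + i"
        using i by (metis DiffD1 atLeastAtMost_iff le_add_diff_inverse2 mult.commute)
      then have "(a * n + b) mod n = (k * n + i) mod n" by simp
      then show False using i True assms(2) by simp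
    qed
    then show ?thesis by (simp add: fps_nth_compose_X_power)
  next
    case False
    then show ?thesis using assms(1) by (simp add: coeff_eq_0)
  qed
  then have "(fps_of_poly P * (G oo fps_X ^ n)) $ (a * n + b) =
      (\<Sum>i\<in>{b}. coeff P i * (G oo fps_X ^ n) $ (a * n + b - i))"
    unfolding fps_mult_nth fps_of_poly_nth
    by (intro sum.mono_neutral_right) (auto simp del: mult_eq_0_iff)
  then show ?thesis using n by (simp add: fps_nth_compose_X_power)
qed

text \<open>The same P serves all c; this is what later allows comparison with c = 0.\<close>

lemma q_delannoy_fps_mult_primitive_root:
  assumes "n > 0" and z: "z \<in> primitive_roots n" and "d < n"
  obtains P where "degree P < n"
    and "\<And>c. q_delannoy_fps z (c * n + d) * (1 - fps_X ^ n) ^ Suc c =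
      fps_of_poly P * (1 - fps_const ((- 1) ^ n) * fps_X ^ n) ^ c"
proof -
  have zn: "z ^ n = 1" using z by (simp add: primitive_roots_def)
  then have z0: "z \<noteq> 0" using assms(1) by (auto simp: power_0_left)
  \<comment> \<open>The incomplete block of the denominator has d + 1 factors; W supplies the n - d
    - 1 missing ones.\<close>
  define W where "W = q_pochhammer_poly (z ^ Suc d) z (n - Suc d)"
  define P where "P = q_pochhammer_poly (- z) z d * W"
  have "degree P \<le> d + (n - Suc d)"
    unfolding P_def W_def
    by (rule order_trans[OF degree_mult_le]) (intro add_mono degree_q_pochhammer_poly_le)
  then have degP: "degree P < n" using assms(3) by simp
  have full: "q_pochhammer_poly 1 z (Suc d) * W = 1 - monom 1 n"
    using q_pochhammer_poly_add[of 1 z "Suc d" "n - Suc d"] assms(3)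
      q_pochhammer_poly_primitive_root[OF assms(1) z, of 1]
    by (simp add: W_def)
  have monom_fps: "fps_of_poly (1 - monom 1 n) = (1 - fps_X ^ n :: complex fps)"
    by (simp add: fps_of_poly_diff fps_of_poly_monom')
  have "q_delannoy_fps z (c * n + d) * (1 - fps_X ^ n) ^ Suc c =
      fps_of_poly P * (1 - fps_const ((- 1) ^ n) * fps_X ^ n) ^ c" for c
  proof -
    have den: "q_pochhammer_poly 1 z (Suc (c * n + d)) * W = (1 - monom 1 n) ^ Suc c"
      using q_pochhammer_poly_mult_add[OF assms(1) z, of 1 c "Suc d"] full
      by (simp add: mult_ac)
    \<comment> \<open>Here s = -z, so a complete block gives 1 - (-z)^n x^n, and (-z)^n =
      (-1)^n.\<close>
    have num: "q_pochhammer_poly (- z) z (c * n + d) * W = P * (1 - monom ((- 1) ^ n) n) ^ c"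
      using q_pochhammer_poly_mult_add[OF assms(1) z, of "- z" c d] z0 zn
      by (simp add: P_def mult_ac power_minus[of z])
    have "q_delannoy_fps z (c * n + d) * (1 - fps_X ^ n) ^ Suc c =
        q_delannoy_fps z (c * n + d) * fps_of_poly (q_pochhammer_poly 1 z (Suc (c * n + d)) * W)"
      by (simp only: den fps_of_poly_power monom_fps)
    also have "\<dots> = fps_of_poly (q_pochhammer_poly (- z) z (c * n + d) * W)"
      by (simp only: fps_of_poly_mult mult.assoc[symmetric] q_delannoy_fps_mult)
    also have "\<dots> = fps_of_poly P * (1 - fps_const ((- 1) ^ n) * fps_X ^ n) ^ c"
      by (simp add: num fps_of_poly_mult fps_of_poly_power fps_of_poly_diff fps_of_poly_monom)
    finally show ?thesis .
  qed
  with degP show ?thesis by (rule that)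
qed

lemma q_delannoy_eval_primitive_root:
  assumes "n > 0" and z: "z \<in> primitive_roots n" and "b < n" "d < n"
  shows "int_poly_eval z (q_delannoy (a * n + b) (c * n + d)) =
    of_nat (delannoy a (if odd n then c else 0)) * int_poly_eval z (q_delannoy b d)"
proof -
  \<comment> \<open>For even n the numerator (1 - x^n)^c cancels all but one factor of the
    denominator, leaving 1/(1 - x^n), the Delannoy series with second argument 0.\<close>
  define e where "e c = (if odd n then c else 0)" for c :: nat
  obtain P where P: "degree P < n"
    and eq: "\<And>c. q_delannoy_fps z (c * n + d) * (1 - fps_X ^ n) ^ Suc c =
      fps_of_poly P * (1 - fps_const ((- 1) ^ n) * fps_X ^ n) ^ c"
    using q_delannoy_fps_mult_primitive_root[OF assms(1) z assms(4)] by blast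
  have "(1 - fps_X ^ n :: complex fps) $ 0 \<noteq> 0"
    using assms(1) by simp
  then have nz: "(1 - fps_X ^ n :: complex fps) \<noteq> 0"
    by (metis fps_zero_nth)
  have fps: "q_delannoy_fps z (c * n + d) = fps_of_poly P * (delannoy_fps (e c) oo fps_X ^ n)" for c
  proof -
    have "(delannoy_fps (e c) oo fps_X ^ n) * (1 - fps_X ^ n) ^ Suc c =
        (1 - fps_const ((- 1) ^ n) * fps_X ^ n) ^ c"
    proof (cases "odd n")
      case True
      then show ?thesis
        using delannoy_fps_compose_mult[OF assms(1), of c]
        by (simp add: e_def fps_const_neg[symmetric] del: power_Suc fps_const_neg)
    next
      case False
      then show ?thesis
        using delannoy_fps_compose_mult[OF assms(1), of 0]
        by (simp add: e_def mult.assoc[symmetric])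
    qed
    then have "q_delannoy_fps z (c * n + d) * (1 - fps_X ^ n) ^ Suc c =
        fps_of_poly P * (delannoy_fps (e c) oo fps_X ^ n) * (1 - fps_X ^ n) ^ Suc c"
      by (simp only: eq mult.assoc)
    moreover have "(1 - fps_X ^ n :: complex fps) ^ Suc c \<noteq> 0" using nz by (rule power_not_zero)
    ultimately show ?thesis by (metis mult_right_cancel)
  qed
  have coeff: "int_poly_eval z (q_delannoy (a * n + b) (c * n + d)) =
      coeff P b * of_nat (delannoy a (e c))" for a c
    using fps_nth_poly_mult_compose_X_power[OF P assms(3), of "delannoy_fps (e c)" a]
    unfolding fps[symmetric] by (simp add: q_delannoy_fps_def delannoy_fps_def)
  show ?thesis
    \<comment> \<open>The instance a = c = 0 identifies \<open>coeff P b\<close> as the value of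
      \<open>q_delannoy b d\<close> at z.\<close>
    using coeff[of 0 0] coeff[of a c] by (simp add: e_def delannoy_0_left)
qed

theorem theorem1p1:
  fixes n a b c d :: nat
  assumes "n \<ge> 1" and "b \<le> n - 1" and "d \<le> n - 1"
  shows "(odd n \<longrightarrow> cyclotomic_poly n dvd
            (q_delannoy (a * n + b) (c * n + d) - of_nat (delannoy a c) * q_delannoy b d)) \<and>
         (even n \<longrightarrow> cyclotomic_poly n dvd
            (q_delannoy (a * n + b) (c * n + d) - q_delannoy b d))"
proof -
  have n: "n > 0" "b < n" "d < n" using assms by auto
  show ?thesis
    using n by (auto intro!: cyclotomic_poly_dvdI
        simp: q_delannoy_eval_primitive_root delannoy_0_right)
qed

end
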